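(* Let $\mathbb K$ be any field, and let $T \in \mathbb K^{n_1\times n_2\times n_3}$ have a decomposition $$T=\sum_{i=1}^r a_i\otimes b_i\otimes c_i,\qquad a_i\in\mathbb K^{n_1},\ b_i\in\mathbb K^{n_2},\ c_i\in\mathbb K^{n_3}.$$ Let $k_a,k_b,k_c$ be the Kruskal ranks of the multisets $\{a_1,\dots,a_r\}$, $\{b_1,\dots,b_r\}$, $\{c_1,\dots,c_r\}$, respectively. If $2r\le k_a+k_b+k_c-1$, then the border rank and the rank of $T$ are both equal to $r$.
   Context: The Kruskal rank of a multiset of $r\ge 1$ nonzero vectors $\{a_1,\dots,a_r\}$ is the largest $\ell\in\{1,\dots,r\}$ such that every sub-multiset of cardinality $\ell$ is linearly independent. The rank of $T\in\mathbb K^{n_1\times n_2\times n_3}$ is the smallest $s$ such that $T$ is a sum of $s$ product tensors $a\otimes b\otimes c$ with $a\in\mathbb K^{n_1}$, $b\in\mathbb K^{n_2}$, $c\in\mathbb K^{n_3}$. The border rank of $T$ is the smallest $s$ such that $T$ lies in the Zariski closure, in $\mathbb K^{n_1\times n_2\times n_3}$, of the set $\{x_1+\dots+x_s \mid x_1,\dots,x_s\in X\}$, where $X=\{a\otimes b\otimes c\mid a\in\mathbb K^{n_1},b\in\mathbb K^{n_2},c\in\mathbb K^{n_3}\}$. *)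

theory Defs
  imports "HOL-Analysis.Analysis" "HOL-Library.Poly_Mapping" "HOL-Library.Multiset"
begin

section \<open>Kruskal rank\<close>

text \<open>A multiset containing a vector more than once is linearly dependent.\<close>

definition mset_independent :: "('k::field ^ 'n) multiset \<Rightarrow> bool" where
  "mset_independent N \<longleftrightarrow> (\<forall>v \<in># N. count N v = 1) \<and> vec.independent (set_mset N)"

text \<open>Only meaningful for nonempty multisets of nonzero vectors: exactly then the set below
  is nonempty (it contains 1).\<close>

definition kruskal_rank :: "('k::field ^ 'n) multiset \<Rightarrow> nat" where
  "kruskal_rank M =
     Max {l \<in> {1..size M}. \<forall>N. N \<subseteq># M \<and> size N = l \<longrightarrow> mset_independent N}"


section \<open>Tensors and rank\<close>

text \<open>Tensors of format \<open>n1 \<times> n2 \<times> n3\<close> are vectors indexed by triples.\<close>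

type_synonym ('k, 'n1, 'n2, 'n3) tensor = "'k ^ ('n1 \<times> 'n2 \<times> 'n3)"

definition product_tensor ::
    "'k::field ^ 'n1 \<Rightarrow> 'k ^ 'n2 \<Rightarrow> 'k ^ 'n3 \<Rightarrow> ('k, 'n1, 'n2, 'n3) tensor" where
  "product_tensor a b c = (\<chi> p. case p of (i, j, l) \<Rightarrow> a $ i * b $ j * c $ l)"

definition product_tensors :: "('k::field, 'n1::finite, 'n2::finite, 'n3::finite) tensor set" where
  "product_tensors = {product_tensor a b c | a b c. True}"

definition product_tensor_sums :: "nat \<Rightarrow> ('k::field, 'n1::finite, 'n2::finite, 'n3::finite) tensor set" where
  "product_tensor_sums s =
     {\<Sum>i\<in>{1..s}. x i | x :: nat \<Rightarrow> ('k, 'n1, 'n2, 'n3) tensor.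
        \<forall>i\<in>{1..s}. x i \<in> product_tensors}"

definition tensor_rank :: "('k::field, 'n1::finite, 'n2::finite, 'n3::finite) tensor \<Rightarrow> nat" where
  "tensor_rank T = (LEAST s. T \<in> product_tensor_sums s)"


section \<open>Zariski closure and border rank\<close>

text \<open>Polynomials over \<open>'k\<close> in variables indexed by \<open>'i\<close>: finitely supported maps from
  monomials (finitely supported exponent maps) to coefficients.\<close>

type_synonym ('i, 'k) mv_poly = "('i \<Rightarrow>\<^sub>0 nat) \<Rightarrow>\<^sub>0 'k"

definition mv_eval :: "('i, 'k::field) mv_poly \<Rightarrow> 'k ^ 'i \<Rightarrow> 'k" where
  "mv_eval p x =
     (\<Sum>m \<in> Poly_Mapping.keys p. Poly_Mapping.lookup p m *
        (\<Prod>i \<in> Poly_Mapping.keys m. (x $ i) ^ Poly_Mapping.lookup m i))"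

text \<open>The closure among the \<open>'k\<close>-rational points of affine space; \<open>'k\<close> need be neither
  algebraically closed nor infinite.\<close>

definition zariski_closure :: "('k::field ^ 'i) set \<Rightarrow> ('k ^ 'i) set" where
  "zariski_closure S =
     {x. \<forall>p :: ('i, 'k) mv_poly. (\<forall>y\<in>S. mv_eval p y = 0) \<longrightarrow> mv_eval p x = 0}"

definition border_rank :: "('k::field, 'n1::finite, 'n2::finite, 'n3::finite) tensor \<Rightarrow> nat" where
  "border_rank T = (LEAST s. T \<in> zariski_closure (product_tensor_sums s))"

end

theory Submission
  imports Defs "Jordan_Normal_Form.Determinant"
begin

text \<open>
  Let \<open>A\<close> be the span of the \<open>a\<^sub>i\<close> and \<open>N = dim A \<ge> k\<^sub>a\<close>. With \<open>p = r - k\<^sub>b\<close> and \<open>q = N - 1 - p\<close> the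
  Kruskal condition gives \<open>r - q \<le> k\<^sub>c\<close>. The \<open>p\<close>-th Koszul flattening
  \<open>\<Lambda>\<^sup>pA \<otimes> B\<^sup>* \<rightarrow> \<Lambda>\<^sup>p\<^sup>+\<^sup>1A \<otimes> C\<close> depends linearly on the tensor and has rank at most
  \<open>N - 1 choose p\<close> on product tensors. On \<open>T\<close> its rank is \<open>r\<close> times that number: any \<open>r - p\<close> of the
  \<open>b\<^sub>i\<close> and any \<open>r - q\<close> of the \<open>c\<^sub>i\<close> are independent, so after wedging with \<open>p\<close> resp. \<open>q\<close> further
  vectors \<open>a\<^sub>i\<close>, which kills their summands, every remaining summand of \<open>T\<close> can be isolated by dual
  functionals. A suitable minor thus vanishes on all sums of fewer than \<open>r\<close> product tensors, but
  not on \<open>T\<close>. No generic choice is involved, so small fields need no special treatment.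
\<close>

subsection \<open>Determinants\<close>

text \<open>The matrix factors through a space of dimension \<open>card K < m\<close>. Both factors
  are padded with zeros to size m, so that the determinant is multiplicative; column number
  \<open>card K\<close> of the left one is then zero and meets every Leibniz product.\<close>

lemma det_low_rank:
  fixes f :: "nat \<Rightarrow> 'b \<Rightarrow> 'k::field"
  assumes K: "finite K" "card K < m"
  shows "Determinant.det (Matrix.mat m m (\<lambda>(i, j). \<Sum>k\<in>K. f i k * g k j)) = 0"
proof -
  obtain h where h: "bij_betw h {0..<card K} K"
    using K(1) ex_bij_betw_nat_finite by blast
  define P where "P = Matrix.mat m m (\<lambda>(i, k). if k < card K then f i (h k) else 0)"
  define Q where "Q = Matrix.mat m m (\<lambda>(k, j). if k < card K then g (h k) j else 0)"
  have PQ: "P \<in> carrier_mat m m" "Q \<in> carrier_mat m m" by (auto simp: P_def Q_def)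
  have "Matrix.mat m m (\<lambda>(i, j). \<Sum>k\<in>K. f i k * g k j) = P * Q"
  proof (intro eq_matI; simp add: PQ(1,2)[THEN carrier_matD(1)] PQ(1,2)[THEN carrier_matD(2)])
    fix i j assume ij: "i < m" "j < m"
    have "(P * Q) $$ (i, j) = (\<Sum>k = 0..<m. P $$ (i, k) * Q $$ (k, j))"
      using ij PQ by (simp add: scalar_prod_def)
    also have "\<dots> = (\<Sum>k\<in>{0..<card K}. f i (h k) * g (h k) j)"
      using ij K(2) by (intro sum.mono_neutral_cong_right) (auto simp: P_def Q_def)
    also have "\<dots> = (\<Sum>k\<in>K. f i k * g k j)"
      by (rule sum.reindex_bij_betw[OF h])
    finally show "(\<Sum>k\<in>K. f i k * g k j) = Matrix.row P i \<bullet> Matrix.col Q j"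
      using ij PQ by simp
  qed
  moreover have "Determinant.det P = 0"
  proof -
    have "Determinant.det P = (\<Sum>\<pi> | \<pi> permutes {0..<m}. signof \<pi> * (\<Prod>i = 0..<m. P $$ (\<pi> i, i)))"
      using mat_det_left_def[OF PQ(1)] PQ(1) by simp
    also have "\<dots> = 0"
    proof (intro sum.neutral ballI)
      fix \<pi> assume "\<pi> \<in> {\<pi>. \<pi> permutes {0..<m}}"
      then have "\<pi> (card K) < m"
        using K(2) permutes_in_image[of \<pi> "{0..<m}" "card K"] by simp
      then have "P $$ (\<pi> (card K), card K) = 0"
        using K(2) by (simp add: P_def)
      then show "signof \<pi> * (\<Prod>i = 0..<m. P $$ (\<pi> i, i)) = 0"
        using K(2) by (auto simp: prod_zero_iff intro!: bexI[of _ "card K"])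
    qed
    finally show ?thesis .
  qed
  ultimately show ?thesis
    using det_mult[OF PQ] by simp
qed

lemma det_diagonal:
  fixes f :: "nat \<Rightarrow> nat \<Rightarrow> 'k::field"
  assumes "\<And>i j. i < m \<Longrightarrow> j < m \<Longrightarrow> i \<noteq> j \<Longrightarrow> f i j = 0" "\<And>i. i < m \<Longrightarrow> f i i \<noteq> 0"
  shows "Determinant.det (Matrix.mat m m (\<lambda>(i, j). f i j)) \<noteq> 0"
proof -
  have "Determinant.det (Matrix.mat m m (\<lambda>(i, j). f i j)) = prod_list (diag_mat (Matrix.mat m m (\<lambda>(i, j). f i j)))"
    by (rule det_lower_triangular[of m]) (use assms in auto)
  also have "\<dots> \<noteq> 0"
    using assms(2) by (auto simp: prod_list_zero_iff diag_mat_def)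
  finally show ?thesis .
qed

subsection \<open>Polynomial functions\<close>

text \<open>Membership in a Zariski closure depends only on the values of polynomials, so it is
  enough to work with functions; over a finite field several polynomials represent the same
  one.\<close>

definition mv_polynomial :: "('k::field ^ 'i::finite \<Rightarrow> 'k) \<Rightarrow> bool" where
  "mv_polynomial f \<longleftrightarrow> (\<exists>p :: ('i, 'k) mv_poly. \<forall>x. mv_eval p x = f x)"

text \<open>Absent monomials have coefficient 0 and absent variables exponent 0. Common index sets
  let evaluations of different polynomials be compared term by term.\<close>

lemma mv_eval_superset:
  fixes p :: "('i::finite, 'k::field) mv_poly"
  assumes "finite A" "Poly_Mapping.keys p \<subseteq> A"
  shows "mv_eval p x = (\<Sum>m\<in>A. Poly_Mapping.lookup p m * (\<Prod>i\<in>UNIV. (vec_nth x i) ^ Poly_Mapping.lookup m i))"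
proof -
  have "(\<Prod>i\<in>Poly_Mapping.keys m. (vec_nth x i) ^ Poly_Mapping.lookup m i) =
      (\<Prod>i\<in>UNIV. (vec_nth x i) ^ Poly_Mapping.lookup m i)" for m :: "'i \<Rightarrow>\<^sub>0 nat"
    by (intro prod.mono_neutral_left) (auto simp: in_keys_iff)
  then show ?thesis
    unfolding mv_eval_def using assms
    by (intro sum.mono_neutral_cong_left) (auto simp: in_keys_iff)
qed

lemma mv_polynomial_monom:
  fixes m :: "'i::finite \<Rightarrow>\<^sub>0 nat"
  shows "mv_polynomial (\<lambda>x :: 'k::field ^ 'i. c * (\<Prod>i\<in>UNIV. (vec_nth x i) ^ Poly_Mapping.lookup m i))"
  unfolding mv_polynomial_def
proof (intro exI allI)
  fix x :: "'k ^ 'i"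
  show "mv_eval (Poly_Mapping.single m c) x = c * (\<Prod>i\<in>UNIV. (vec_nth x i) ^ Poly_Mapping.lookup m i)"
    by (subst mv_eval_superset[of "{m}"]) auto
qed

lemma mv_polynomial_add:
  assumes "mv_polynomial f" "mv_polynomial g"
  shows "mv_polynomial (\<lambda>x. f x + g x)"
proof -
  obtain p q where pq: "\<And>x. mv_eval p x = f x" "\<And>x. mv_eval q x = g x"
    using assms unfolding mv_polynomial_def by blast
  have "mv_eval (p + q) x = f x + g x" for x
    unfolding pq[symmetric]
    using Poly_Mapping.keys_add[of p q]
    by (subst (1 2 3) mv_eval_superset[of "Poly_Mapping.keys p \<union> Poly_Mapping.keys q"])
      (auto simp: lookup_add distrib_right sum.distrib)
  then show ?thesis unfolding mv_polynomial_def by blast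
qed

lemma mv_polynomial_const: "mv_polynomial (\<lambda>_. c)"
  using mv_polynomial_monom[of c 0] by simp

lemma mv_polynomial_sum:
  assumes "\<And>a. a \<in> A \<Longrightarrow> mv_polynomial (f a)"
  shows "mv_polynomial (\<lambda>x. \<Sum>a\<in>A. f a x)"
  using assms
  by (induction A rule: infinite_finite_induct) (auto intro: mv_polynomial_add mv_polynomial_const)

lemma mv_polynomial_mult:
  assumes "mv_polynomial f" "mv_polynomial g"
  shows "mv_polynomial (\<lambda>x. f x * g x)"
proof -
  obtain p q where pq: "\<And>x. mv_eval p x = f x" "\<And>x. mv_eval q x = g x"
    using assms unfolding mv_polynomial_def by blast
  \<comment> \<open>Multiplying out the two evaluations gives monomials with added exponents, each
    of which is a polynomial function.\<close>
  have "f x * g x = (\<Sum>m\<in>Poly_Mapping.keys p. \<Sum>n\<in>Poly_Mapping.keys q.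
      (Poly_Mapping.lookup p m * Poly_Mapping.lookup q n) *
      (\<Prod>i\<in>UNIV. (vec_nth x i) ^ Poly_Mapping.lookup (m + n) i))" for x
    unfolding pq[symmetric]
    by (simp add: mv_eval_superset[OF finite_keys subset_refl] sum_product lookup_add power_add
        prod.distrib mult_ac)
  then have "(\<lambda>x. f x * g x) = (\<lambda>x. \<Sum>m\<in>Poly_Mapping.keys p. \<Sum>n\<in>Poly_Mapping.keys q.
      (Poly_Mapping.lookup p m * Poly_Mapping.lookup q n) *
      (\<Prod>i\<in>UNIV. (vec_nth x i) ^ Poly_Mapping.lookup (m + n) i))" by blast
  then show ?thesis
    by (simp only:) (intro mv_polynomial_sum mv_polynomial_monom)
qed

lemma mv_polynomial_prod:
  assumes "\<And>a. a \<in> A \<Longrightarrow> mv_polynomial (f a)"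
  shows "mv_polynomial (\<lambda>x. \<Prod>a\<in>A. f a x)"
  using assms
  by (induction A rule: infinite_finite_induct) (auto intro: mv_polynomial_mult mv_polynomial_const)

lemma mv_polynomial_coord:
  fixes i :: "'i::finite"
  shows "mv_polynomial (\<lambda>x :: 'k::field ^ 'i. vec_nth x i)"
proof -
  have "(\<Prod>j\<in>UNIV. (vec_nth x j) ^ Poly_Mapping.lookup (Poly_Mapping.single i 1) j) = vec_nth x i"
    for x :: "'k ^ 'i"
    by (subst prod.remove[of _ i]) (auto simp: lookup_single when_def intro!: prod.neutral)
  then show ?thesis
    using mv_polynomial_monom[of "1::'k" "Poly_Mapping.single i 1"] by simp
qed

lemma mv_polynomial_det:
  assumes "\<And>i j. mv_polynomial (f i j)"
  shows "mv_polynomial (\<lambda>x. Determinant.det (Matrix.mat m m (\<lambda>(i, j). f i j x)))"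
proof -
  have "Determinant.det (Matrix.mat m m (\<lambda>(i, j). f i j x)) =
      (\<Sum>\<pi> | \<pi> permutes {0..<m}. signof \<pi> * (\<Prod>i = 0..<m. f i (\<pi> i) x))" for x
    using permutes_in_image
    by (subst det_def'[of _ m]) (fastforce intro!: sum.cong prod.cong arg_cong2[of _ _ _ _ "(*)"])+
  then show ?thesis
    by (simp only:)
      (intro mv_polynomial_sum mv_polynomial_mult mv_polynomial_const mv_polynomial_prod assms)
qed

subsection \<open>Alternating forms\<close>

text \<open>The vectors are the rows, and only their values below n count. Keeping them in a list
  turns exterior products into concatenations.\<close>

definition vol :: "nat \<Rightarrow> (nat \<Rightarrow> 'k::field) list \<Rightarrow> 'k" where
  "vol n xs = Determinant.det (Matrix.mat n n (\<lambda>(i, j). (xs ! i) j))"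

lemma vol_expand:
  fixes y :: "'b \<Rightarrow> nat \<Rightarrow> 'k::field"
  assumes k: "k < n" and len: "length xs = n" and B: "finite B"
    and v: "\<And>j. j < n \<Longrightarrow> v j = (\<Sum>b\<in>B. s b * y b j)"
  shows "vol n (xs[k := v]) = (\<Sum>b\<in>B. s b * vol n (xs[k := y b]))"
proof -
  \<comment> \<open>Each Leibniz product contains exactly one entry of row k, so the determinant is
    linear in that row.\<close>
  have row: "vol n (xs[k := w]) = (\<Sum>\<pi> | \<pi> permutes {0..<n}.
      signof \<pi> * (\<Prod>i\<in>{0..<n} - {k}. (xs ! i) (\<pi> i)) * w (\<pi> k))" for w :: "nat \<Rightarrow> 'k"
  proof -
    have "(\<Prod>i = 0..<n. Matrix.mat n n (\<lambda>(i, j). (xs[k := w] ! i) j) $$ (i, \<pi> i)) =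
        (\<Prod>i\<in>{0..<n} - {k}. (xs ! i) (\<pi> i)) * w (\<pi> k)" if \<pi>: "\<pi> permutes {0..<n}" for \<pi>
    proof -
      have "(\<Prod>i = 0..<n. Matrix.mat n n (\<lambda>(i, j). (xs[k := w] ! i) j) $$ (i, \<pi> i)) =
          (\<Prod>i = 0..<n. (xs[k := w] ! i) (\<pi> i))"
        using permutes_in_image[OF \<pi>] by (intro prod.cong) auto
      also have "\<dots> = (\<Prod>i\<in>{0..<n} - {k}. (xs[k := w] ! i) (\<pi> i)) * (xs[k := w] ! k) (\<pi> k)"
        using k by (subst prod.remove[of _ k]) (auto simp: mult.commute)
      finally show ?thesis using k len by simp
    qed
    then show ?thesis
      unfolding vol_def by (subst det_def'[of _ n]) (auto intro!: sum.cong simp: mult.assoc)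
  qed
  have "vol n (xs[k := v]) = (\<Sum>\<pi> | \<pi> permutes {0..<n}.
      signof \<pi> * (\<Prod>i\<in>{0..<n} - {k}. (xs ! i) (\<pi> i)) * (\<Sum>b\<in>B. s b * y b (\<pi> k)))"
    unfolding row
    by (intro sum.cong refl) (use k v permutes_in_image in fastforce)
  also have "\<dots> = (\<Sum>b\<in>B. \<Sum>\<pi> | \<pi> permutes {0..<n}.
      s b * (signof \<pi> * (\<Prod>i\<in>{0..<n} - {k}. (xs ! i) (\<pi> i)) * y b (\<pi> k)))"
    unfolding sum_distrib_left by (subst sum.swap) (simp add: mult_ac)
  finally show ?thesis
    unfolding row sum_distrib_left .
qed

lemma vol_not_distinct:
  assumes "length xs = n" "\<not> distinct xs"
  shows "vol n xs = 0"
proof -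
  obtain i j where ij: "i < n" "j < n" "i \<noteq> j" "xs ! i = xs ! j"
    using assms by (auto simp: distinct_conv_nth)
  show ?thesis
    unfolding vol_def
    by (rule Determinant.det_identical_rows[of _ n i j]) (use ij in \<open>auto simp: Matrix.row_def\<close>)
qed

text \<open>A permutation of the prefix extends by the identity to all n rows. Its sign does not
  depend on \<open>ws\<close>, so \<open>\<epsilon>\<close> can serve as a coefficient in
  \<open>vol_factor\<close>.\<close>

lemma vol_permute:
  assumes "mset us = mset vs" "length vs \<le> n"
  obtains \<epsilon> :: "'k::field" where "\<And>ws. length (vs @ ws) = n \<Longrightarrow> vol n (us @ ws) = \<epsilon> * vol n (vs @ ws)"
proof -
  from assms(1) obtain f where f: "f permutes {..<length vs}" "permute_list f vs = us"
    by (rule mset_eq_permutation)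
  have fn: "f permutes {0..<n}"
    using permutes_subset[OF f(1)] assms(2) by (auto simp: lessThan_atLeast0)
  have "vol n (us @ ws) = signof f * vol n (vs @ ws)" if len: "length (vs @ ws) = n" for ws :: "(nat \<Rightarrow> 'k) list"
  proof -
    have nth: "(us @ ws) ! i = (vs @ ws) ! f i" if "i < n" for i
    proof (cases "i < length vs")
      case True
      then have "f i < length vs"
        using permutes_in_image[OF f(1), of i] by simp
      then show ?thesis
        using True permute_list_nth[OF f(1) True] f(2) length_permute_list[of f vs]
        by (simp add: nth_append)
    next
      case False
      then have "f i = i"
        using f(1) by (auto simp: permutes_def)
      then show ?thesis
        using False length_permute_list[of f vs] f(2) by (simp add: nth_append)
    qed
    have eq: "Matrix.mat n n (\<lambda>(i, j). ((us @ ws) ! i) j) =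
        Matrix.mat n n (\<lambda>(i, j). Matrix.mat n n (\<lambda>(i, j). ((vs @ ws) ! i) j) $$ (f i, j))"
      using nth permutes_in_image[OF fn] by (intro eq_matI) auto
    show ?thesis
      unfolding vol_def
      by (rule trans[OF arg_cong[OF eq, of Determinant.det] Determinant.det_permute_rows[OF _ fn]]) simp
  qed
  then show thesis by (rule that)
qed

text \<open>For fixed \<open>x\<close>, the form \<open>vol\<close> only sees the other vectors modulo \<open>x\<close>, and \<open>p\<close>-fold
  exterior products in the quotient are spanned by those of \<open>p\<close>-subsets of a basis.\<close>

lemma vol_factor:
  fixes x :: "nat \<Rightarrow> 'k::field"
  obtains K :: "nat set set" and \<phi> \<psi> where
    "finite K" "card K = (p + q) choose p"
    "\<And>us ws. length us = p \<Longrightarrow> length ws = q \<Longrightarrow>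
       vol (Suc (p + q)) (us @ x # ws) = (\<Sum>V\<in>K. \<phi> V us * \<psi> V ws)"
proof -
  define n where "n = Suc (p + q)"
  show thesis
  proof (cases "\<exists>l<n. x l \<noteq> 0")
    case False
    \<comment> \<open>Here x vanishes in all n coordinates and so does \<open>vol\<close>; K only
      has to have the right size.\<close>
    define K where "K = {V. V \<subseteq> {..<p + q} \<and> card V = p}"
    have "vol n (us @ x # ws) = 0" if "length us = p" "length ws = q" for us ws
      using vol_expand[of p n "us @ x # ws" "{}" x "\<lambda>_. 0" "\<lambda>_ _. 0"] False that
      by (auto simp: n_def list_update_append)
    then show thesis
      using that[of K "\<lambda>_ _. 0" "\<lambda>_ _. 0"] n_subsets[of "{..<p + q}" p]
      by (auto simp: K_def n_def)
  next
    case True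
    then obtain l where l: "l < n" "x l \<noteq> 0" by blast
    \<comment> \<open>The standard basis with the l-th vector replaced by x, which is again a basis
      because \<open>x l\<close> is nonzero. The other p + q vectors, indexed by D, represent a
      basis modulo x.\<close>
    define y where "y b = (if b = l then x else (\<lambda>j. if j = b then 1 else 0))" for b
    define D where "D = {..<n} - {l}"
    define K where "K = {V. V \<subseteq> D \<and> card V = p}"
    define \<psi> where "\<psi> V ws = vol n (map y (sorted_list_of_set V) @ x # ws)" for V ws
    have finD: "finite D" and lD: "l \<notin> D" and yl: "y l = x"
      by (auto simp: D_def y_def)
    have finK: "finite K" and cardK: "card K = (p + q) choose p"
      using n_subsets[of D p] l by (auto simp: K_def D_def n_def)
    \<comment> \<open>Distinct basis vectors are sorted at the cost of a sign; a repeated one makes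
      \<open>vol\<close> zero.\<close>
    have basis: "\<exists>c. \<forall>ws. length ws = q \<longrightarrow> vol n (map y bs @ x # ws) = (\<Sum>V\<in>K. c V * \<psi> V ws)"
      if bs: "length bs = p" "set bs \<subseteq> D" for bs
    proof (cases "distinct bs")
      case True
      define V where "V = set bs"
      have "finite V" "V \<in> K"
        using bs True distinct_card[OF True] by (auto simp: V_def K_def)
      have "mset bs = mset (sorted_list_of_set V)"
        using True by (metis V_def List.finite_set distinct_sorted_list_of_set set_eq_iff_mset_eq_distinct set_sorted_list_of_set)
      then have eq: "mset (map y bs) = mset (map y (sorted_list_of_set V))" by simp
      have len: "length (map y (sorted_list_of_set V)) = p"
        using \<open>V \<in> K\<close> by (simp add: K_def)
      then have le: "length (map y (sorted_list_of_set V)) \<le> n" by (simp add: n_def)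
      obtain \<epsilon> :: 'k where \<epsilon>: "\<And>ws. length (map y (sorted_list_of_set V) @ ws) = n \<Longrightarrow>
          vol n (map y bs @ ws) = \<epsilon> * vol n (map y (sorted_list_of_set V) @ ws)"
        by (rule vol_permute[OF eq le]) (rule that)
      have "vol n (map y bs @ x # ws) = (\<Sum>V'\<in>K. (if V' = V then \<epsilon> else 0) * \<psi> V' ws)"
        if "length ws = q" for ws
        using \<epsilon>[of "x # ws"] that \<open>V \<in> K\<close> finK len
        by (simp add: n_def \<psi>_def if_distrib[where f = "\<lambda>z. z * _"] cong: if_cong)
      then show ?thesis by (intro exI[of _ "\<lambda>V'. if V' = V then \<epsilon> else 0"]) blast
    next
      case False
      then have "vol n (map y bs @ x # ws) = 0" if "length ws = q" for ws
        using that bs by (intro vol_not_distinct) (auto simp: n_def distinct_map)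
      then show ?thesis by (intro exI[of _ "\<lambda>_. 0"]) simp
    qed
    \<comment> \<open>The vectors of \<open>us\<close> are replaced by basis vectors one at a time
      from the right; \<open>bs\<close> collects the indices already chosen.\<close>
    have ex: "\<exists>c. \<forall>ws. length ws = q \<longrightarrow> vol n (us @ map y bs @ x # ws) = (\<Sum>V\<in>K. c V * \<psi> V ws)"
      if "length us + length bs = p" "set bs \<subseteq> D" for us bs
      using that
    proof (induction us arbitrary: bs rule: rev_induct)
      case Nil
      then show ?case using basis by simp
    next
      case (snoc u us)
      \<comment> \<open>The coordinates of u in the basis y: the multiple of x is fixed by
        coordinate l and then subtracted from the others.\<close>
      define s where "s b = (if b = l then u l / x l else u b - u l / x l * x b)" for b
      have u: "u j = (\<Sum>b\<in>insert l D. s b * y b j)" if "j < n" for j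
      proof -
        have "(\<Sum>b\<in>insert l D. s b * y b j) = s l * y l j + (\<Sum>b\<in>D. s b * y b j)"
          by (simp add: finD lD)
        also have "(\<Sum>b\<in>D. s b * y b j) = (\<Sum>b\<in>D. if b = j then s j else 0)"
          by (intro sum.cong) (auto simp: D_def y_def)
        also have "\<dots> = (if j = l then 0 else s j)"
          using that by (auto simp: D_def)
        finally show ?thesis using l by (auto simp: s_def y_def)
      qed
      have "\<forall>b\<in>D. \<exists>c. \<forall>ws. length ws = q \<longrightarrow>
          vol n (us @ map y (b # bs) @ x # ws) = (\<Sum>V\<in>K. c V * \<psi> V ws)"
        using snoc.prems by (intro ballI snoc.IH) auto
      then obtain c where c: "\<And>b ws. b \<in> D \<Longrightarrow> length ws = q \<Longrightarrow>
          vol n (us @ map y (b # bs) @ x # ws) = (\<Sum>V\<in>K. c b V * \<psi> V ws)"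
        by metis
      have "vol n ((us @ [u]) @ map y bs @ x # ws) = (\<Sum>V\<in>K. (\<Sum>b\<in>D. s b * c b V) * \<psi> V ws)"
        if ws: "length ws = q" for ws
      proof -
        define xs where "xs = us @ u # map y bs @ x # ws"
        have upd: "xs[length us := w] = us @ w # map y bs @ x # ws" for w
          by (simp add: xs_def)
        have len: "length xs = n" "length us < n"
          using snoc.prems ws by (auto simp: xs_def n_def)
        have "vol n (xs[length us := u]) = (\<Sum>b\<in>insert l D. s b * vol n (xs[length us := y b]))"
          by (rule vol_expand) (use len u in \<open>auto simp: D_def\<close>)
        also have "\<dots> = s l * vol n (us @ x # map y bs @ x # ws) +
            (\<Sum>b\<in>D. s b * vol n (us @ map y (b # bs) @ x # ws))"
          by (simp add: upd finD lD yl)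
        \<comment> \<open>The component of u along x drops out because x then occurs twice.\<close>
        also have "vol n (us @ x # map y bs @ x # ws) = 0"
          using len by (intro vol_not_distinct) (auto simp: xs_def)
        also have "(\<Sum>b\<in>D. s b * vol n (us @ map y (b # bs) @ x # ws)) =
            (\<Sum>b\<in>D. s b * (\<Sum>V\<in>K. c b V * \<psi> V ws))"
          using c ws by simp
        also have "\<dots> = (\<Sum>V\<in>K. (\<Sum>b\<in>D. s b * c b V) * \<psi> V ws)"
          unfolding sum_distrib_left sum_distrib_right
          by (subst sum.swap) (simp add: mult_ac)
        finally show ?thesis by (simp add: upd)
      qed
      then show ?case by (intro exI[of _ "\<lambda>V. \<Sum>b\<in>D. s b * c b V"]) blast
    qed
    have "\<exists>c. \<forall>us ws. length us = p \<longrightarrow> length ws = q \<longrightarrow>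
        vol n (us @ x # ws) = (\<Sum>V\<in>K. c us V * \<psi> V ws)"
      using ex[of _ "[]"] by simp metis
    then obtain c where "\<And>us ws. length us = p \<Longrightarrow> length ws = q \<Longrightarrow>
        vol n (us @ x # ws) = (\<Sum>V\<in>K. c us V * \<psi> V ws)"
      by blast
    then show thesis
      using that[OF finK cardK, of "\<lambda>V us. c us V" \<psi>] by (simp add: n_def)
  qed
qed

subsection \<open>Kruskal rank and dual functionals\<close>

text \<open>Single nonzero vectors are independent, so the maximum is over a nonempty set and is
  attained there. The smaller subsets inherit independence from those of size k.\<close>

lemma kruskal_rank_independent:
  fixes a :: "'i \<Rightarrow> 'k::field ^ 'n"
  assumes I: "finite I" "I \<noteq> {}" and nz: "\<And>i. i \<in> I \<Longrightarrow> a i \<noteq> 0"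
  defines "k \<equiv> kruskal_rank (image_mset a (mset_set I))"
  shows "1 \<le> k" "k \<le> card I"
    and "J \<subseteq> I \<Longrightarrow> card J \<le> k \<Longrightarrow> inj_on a J \<and> vec.independent (a ` J)"
proof -
  define M where "M = image_mset a (mset_set I)"
  define A where "A = {l \<in> {1..size M}. \<forall>N. N \<subseteq># M \<and> size N = l \<longrightarrow> mset_independent N}"
  have "mset_independent N" if "N \<subseteq># M" "size N = 1" for N
  proof -
    obtain v where v: "N = {#v#}"
      using size_1_singleton_mset \<open>size N = 1\<close> by blast
    then have "v \<in># M" using \<open>N \<subseteq># M\<close> by (simp add: mset_subset_eq_insertD)
    then have "v \<noteq> 0" using I nz by (auto simp: M_def)
    then show ?thesis by (simp add: mset_independent_def v)
  qed
  moreover have "size M = card I" by (simp add: M_def)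
  moreover have "card I \<ge> 1" using I by (simp add: Suc_leI card_gt_0_iff)
  ultimately have "1 \<in> A" by (auto simp: A_def)
  moreover have "finite A" by (simp add: A_def)
  moreover have "k = Max A" by (simp add: k_def kruskal_rank_def A_def M_def)
  ultimately have k: "k \<in> A" using Max_in by blast
  then show k1: "1 \<le> k" and kI: "k \<le> card I" by (auto simp: A_def M_def)
  assume J: "J \<subseteq> I" "card J \<le> k"
  \<comment> \<open>The defining property of k concerns size exactly k, so J is first
    enlarged.\<close>
  obtain J' where J': "J \<subseteq> J'" "J' \<subseteq> I" "card J' = k"
    using exists_subset_between[of J k I] J kI I by blast
  have finJ': "finite J'" using J' I finite_subset by blast
  have "image_mset a (mset_set J') \<subseteq># M"
    unfolding M_def using J' I by (intro image_mset_subseteq_mono) (simp add: subset_imp_msubset_mset_set)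
  then have ind: "mset_independent (image_mset a (mset_set J'))"
    using k J' by (auto simp: A_def)
  \<comment> \<open>A repeated vector would have multiplicity at least 2, which
    \<open>mset_independent\<close> excludes.\<close>
  have "inj_on a J'"
  proof (rule inj_onI, rule ccontr)
    fix i j assume ij: "i \<in> J'" "j \<in> J'" "a i = a j" "i \<noteq> j"
    have "count (image_mset a (mset_set J')) (a i) = card {x \<in> J'. a x = a i}"
      using finJ' by (auto simp: count_image_mset_eq_card_vimage intro!: arg_cong[where f = card])
    moreover have "card {i, j} \<le> card {x \<in> J'. a x = a i}"
      using ij finJ' by (intro card_mono) auto
    ultimately show False
      using ind ij finJ' by (auto simp: mset_independent_def)
  qed
  moreover have "vec.independent (a ` J')"
    using ind finJ' by (auto simp: mset_independent_def)
  ultimately show "inj_on a J \<and> vec.independent (a ` J)"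
    using J'(1) by (meson image_mono inj_on_subset vec.independent_mono)
qed

text \<open>The functional is the coordinate belonging to \<open>a j\<close> in a basis extending
  the given independent vectors.\<close>

lemma dual_functional:
  fixes a :: "'i \<Rightarrow> 'k::field ^ 'n"
  assumes "inj_on a J \<and> vec.independent (a ` J)" "j \<in> J"
  shows "\<exists>g. Vector_Spaces.linear (*s) (*) g \<and> g (a j) = 1 \<and> (\<forall>i\<in>J - {j}. g (a i) = 0)"
proof -
  define B where "B = vec.extend_basis (a ` J)"
  have ind: "vec.independent (a ` J)" using assms by blast
  note B = vec.independent_extend_basis[OF ind, folded B_def]
    vec.span_extend_basis[OF ind, folded B_def]
    vec.extend_basis_superset[OF ind, folded B_def]
  have "Vector_Spaces.linear (*s) (*) (\<lambda>v. vec.representation B v (a j))"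
    using B by (intro vec.linear_representation)
  moreover have "vec.representation B (a j) (a j) = 1"
    using B assms by (subst vec.representation_basis) auto
  moreover have "vec.representation B (a i) (a j) = 0" if "i \<in> J - {j}" for i
    using B assms that by (subst vec.representation_basis) (auto simp: inj_on_def)
  ultimately show ?thesis by blast
qed

text \<open>N is the dimension of the span of the \<open>a i\<close>. The map
  \<open>\<kappa>\<close> takes coordinates in a basis of this span, extended linearly to the whole
  space so that it applies to arbitrary product tensors; it is injective on the span, hence
  \<open>vol N\<close> does not vanish on bases of the span.\<close>

lemma spanning_coordinates:
  fixes a :: "'i \<Rightarrow> 'k::field ^ 'n"
  assumes I: "finite I" and nz: "\<forall>i\<in>I. a i \<noteq> 0"
  obtains \<kappa> :: "'k ^ 'n \<Rightarrow> nat \<Rightarrow> 'k" and J :: "'i \<Rightarrow> 'i set" and N :: nat where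
    "\<And>l. Vector_Spaces.linear (*s) (*) (\<lambda>x. \<kappa> x l)"
    "\<And>j. j \<in> I \<Longrightarrow> J j \<subseteq> I - {j} \<and> Suc (card (J j)) = N"
    "\<And>j js. j \<in> I \<Longrightarrow> distinct js \<Longrightarrow> set js = insert j (J j) \<Longrightarrow> vol N (map (\<lambda>i. \<kappa> (a i)) js) \<noteq> 0"
    "\<And>L. L \<subseteq> I \<Longrightarrow> inj_on a L \<Longrightarrow> vec.independent (a ` L) \<Longrightarrow> card L \<le> N"
proof -
  obtain E where E: "E \<subseteq> a ` I" "vec.independent E" "a ` I \<subseteq> vec.span E"
    using vec.maximal_independent_subset[of "a ` I"] by blast
  define N where "N = card E"
  have finE: "finite E" using E I finite_subset by blast
  obtain e where e: "bij_betw e {0..<N} E"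
    using finE ex_bij_betw_nat_finite unfolding N_def by blast
  define B where "B = vec.extend_basis E"
  note B = vec.independent_extend_basis[OF E(2), folded B_def]
    vec.span_extend_basis[OF E(2), folded B_def]
    vec.extend_basis_superset[OF E(2), folded B_def]
  define \<kappa> where "\<kappa> x l = vec.representation B x (e l)" for x l
  have lin: "Vector_Spaces.linear (*s) (*) (\<lambda>x. \<kappa> x l)" for l
    unfolding \<kappa>_def using B by (intro vec.linear_representation)
  \<comment> \<open>Injectivity of \<open>\<kappa>\<close> on the span: coordinates in E and in the
    extended basis B agree there.\<close>
  have zero: "z = 0" if z: "z \<in> vec.span E" "\<And>l. l < N \<Longrightarrow> \<kappa> z l = 0" for z
  proof -
    have rep: "vec.representation E z = vec.representation B z"
      using vec.representation_extend[OF B(1) z(1) B(3)] by simp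
    have "vec.representation E z b = 0" for b
    proof (rule ccontr)
      assume *: "vec.representation E z b \<noteq> 0"
      then have "b \<in> E" by (rule vec.representation_ne_zero)
      then obtain l where "l < N" "b = e l"
        using e by (auto simp: bij_betw_def)
      then show False using z(2)[of l] * rep by (simp add: \<kappa>_def)
    qed
    then show ?thesis
      using vec.sum_nonzero_representation_eq[OF E(2) z(1)] by simp
  qed
  \<comment> \<open>Extend \<open>a j\<close> to a basis of the span consisting of vectors
    \<open>a i\<close>, and choose one index for each further vector; all such bases have N
    elements.\<close>
  have ex: "\<exists>J. J \<subseteq> I - {j} \<and> inj_on a (insert j J) \<and> vec.independent (a ` insert j J) \<and> Suc (card J) = N"
    if j: "j \<in> I" for j
  proof -
    have "vec.independent {a j}" using nz j by simp
    then obtain C where C: "{a j} \<subseteq> C" "C \<subseteq> a ` I" "vec.independent C" "a ` I \<subseteq> vec.span C"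
      using vec.maximal_independent_subset_extend[of "{a j}" "a ` I"] j by blast
    have "card C = N"
      unfolding N_def using E C
      by (metis vec.basis_card_eq_dim)
    have "C - {a j} \<subseteq> a ` I" using C by blast
    then obtain J where J: "J \<subseteq> I" "inj_on a J" "a ` J = C - {a j}"
      using subset_image_inj[of "C - {a j}" a I] by metis
    then have "j \<notin> J" by auto
    moreover have "inj_on a (insert j J)" using J by auto
    moreover have "a ` insert j J = C" using J C by auto
    moreover have "Suc (card J) = N"
      using card_image[of a "insert j J"] \<open>card C = N\<close> calculation J I finite_subset[of J I] by simp
    ultimately show ?thesis using J C by (intro exI[of _ J]) auto
  qed
  define J where "J j = (SOME J. J \<subseteq> I - {j} \<and> inj_on a (insert j J) \<and> vec.independent (a ` insert j J) \<and> Suc (card J) = N)" for j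
  have J: "J j \<subseteq> I - {j} \<and> inj_on a (insert j (J j)) \<and> vec.independent (a ` insert j (J j)) \<and> Suc (card (J j)) = N"
    if "j \<in> I" for j
    unfolding J_def using someI_ex[OF ex[OF that]] .
  have "vol N (map (\<lambda>i. \<kappa> (a i)) js) \<noteq> 0"
    if j: "j \<in> I" and js: "distinct js" "set js = insert j (J j)" for j js
  proof
    assume 0: "vol N (map (\<lambda>i. \<kappa> (a i)) js) = 0"
    have len: "length js = N"
    proof -
      have "j \<notin> J j" "finite (J j)"
        using J[OF j] I by (auto intro: finite_subset)
      then show ?thesis
        using js J[OF j] distinct_card[of js] by simp
    qed
    \<comment> \<open>The coordinate vectors, rows in \<open>vol\<close>, become columns here, so a
      kernel vector of A is a linear relation among them and, by \<open>zero\<close>, among the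
      \<open>a i\<close>.\<close>
    define A where "A = Matrix.mat N N (\<lambda>(l, i). \<kappa> (a (js ! i)) l)"
    have A: "A \<in> carrier_mat N N" by (simp add: A_def)
    have AT: "transpose_mat A = Matrix.mat N N (\<lambda>(i, l). (map (\<lambda>i. \<kappa> (a i)) js ! i) l)"
      by (intro eq_matI) (auto simp: A_def len)
    have "Determinant.det A = 0"
      using 0 Determinant.det_transpose[OF A] unfolding vol_def AT by simp
    then obtain v where v: "v \<in> carrier_vec N" "v \<noteq> 0\<^sub>v N" "A *\<^sub>v v = 0\<^sub>v N"
      using det_0_iff_vec_prod_zero_field[OF A] by blast
    define z where "z = (\<Sum>i\<in>{0..<N}. vec_index v i *s a (js ! i))"
    have "js ! i \<in> I" if "i < N" for i
      using nth_mem[of i js] js J[OF j] j that len by auto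
    then have mem: "a (js ! i) \<in> vec.span E" if "i < N" for i
      using E(3) that by blast
    have "z \<in> vec.span E"
      unfolding z_def using mem by (intro vec.span_sum vec.span_scale) auto
    moreover have "\<kappa> z l = 0" if l: "l < N" for l
    proof -
      note hom = module_hom_linearI[OF lin[of l]]
      have "\<kappa> z l = (\<Sum>i\<in>{0..<N}. vec_index v i * \<kappa> (a (js ! i)) l)"
        unfolding z_def
        by (simp add: module_hom.sum[OF hom] module_hom.scale[OF hom])
      also have "\<dots> = vec_index (A *\<^sub>v v) l"
        using l v(1) by (simp add: A_def scalar_prod_def mult.commute)
      finally show ?thesis using v(3) l by simp
    qed
    ultimately have "z = 0" by (rule zero)
    have bij: "bij_betw (\<lambda>i. a (js ! i)) {0..<N} (a ` set js)"
    proof -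
      have "bij_betw ((!) js) {0..<N} (set js)"
        using js(1) len by (intro bij_betw_nth) auto
      moreover have "bij_betw a (set js) (a ` set js)"
        using J[OF j] js(2) by (simp add: bij_betw_def)
      ultimately show ?thesis using bij_betw_trans by (fastforce simp: o_def)
    qed
    \<comment> \<open>Independence concerns coefficients indexed by vectors, so the coefficients are
      moved from list positions to the vectors themselves.\<close>
    define u where "u w = vec_index v (the_inv_into {0..<N} (\<lambda>i. a (js ! i)) w)" for w
    have u: "u (a (js ! i)) = vec_index v i" if "i < N" for i
      using the_inv_into_f_f[OF bij_betw_imp_inj_on[OF bij], of i] that by (simp add: u_def)
    have "(\<Sum>w\<in>a ` set js. u w *s w) = (\<Sum>i\<in>{0..<N}. u (a (js ! i)) *s a (js ! i))"
      by (rule sum.reindex_bij_betw[OF bij, symmetric])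
    also have "\<dots> = z"
      unfolding z_def using u by (intro sum.cong) auto
    finally have "(\<Sum>w\<in>a ` set js. u w *s w) = 0" using \<open>z = 0\<close> by simp
    moreover have "vec.independent (a ` set js)"
      using J[OF j] js(2) by simp
    ultimately have "u w = 0" if "w \<in> a ` set js" for w
      using vec.independentD[OF _ _ subset_refl _ that, of u] by simp
    then have "vec_index v i = 0" if "i < N" for i
      using that len u[OF that] by simp
    then have "v = 0\<^sub>v N"
      using v(1) by (intro eq_vecI) auto
    then show False using v(2) by blast
  qed
  moreover have "card L \<le> N" if "L \<subseteq> I" "inj_on a L" "vec.independent (a ` L)" for L
  proof -
    have "a ` L \<subseteq> vec.span E"
      using that(1) E(3) by blast
    then show ?thesis
      using vec.independent_span_bound[OF finE that(3)] card_image[OF that(2)] by (simp add: N_def)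
  qed
  ultimately show thesis
    using J by (intro that[of \<kappa> J N] lin) auto
qed

subsection \<open>The Koszul minor\<close>

lemma linear_functional_expand:
  fixes f :: "'k::field ^ 'n \<Rightarrow> 'k"
  assumes "Vector_Spaces.linear (*s) (*) f"
  shows "f x = (\<Sum>i\<in>UNIV. vec_nth x i * f (axis i 1))"
proof -
  have "f (\<Sum>i\<in>UNIV. vec_nth x i *s axis i 1) = (\<Sum>i\<in>UNIV. vec_nth x i * f (axis i 1))"
    using module_hom_linearI[OF assms] by (simp add: module_hom.sum module_hom.scale)
  then show ?thesis by (simp only: basis_expansion)
qed

text \<open>For linear f, g, h this is the functional f \<otimes> g \<otimes> h. Written through
  values on standard basis vectors, it is visibly a linear polynomial in the entries of X.\<close>

definition contract ::
    "('k ^ 'n1 \<Rightarrow> 'k) \<Rightarrow> ('k ^ 'n2 \<Rightarrow> 'k) \<Rightarrow> ('k ^ 'n3 \<Rightarrow> 'k) \<Rightarrow>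
      ('k::field, 'n1::finite, 'n2::finite, 'n3::finite) tensor \<Rightarrow> 'k" where
  "contract f g h X =
     (\<Sum>(i, j, l)\<in>UNIV. vec_nth X (i, j, l) * (f (axis i 1) * g (axis j 1) * h (axis l 1)))"

lemma contract_product_tensor:
  assumes "Vector_Spaces.linear (*s) (*) f" "Vector_Spaces.linear (*s) (*) g"
    "Vector_Spaces.linear (*s) (*) h"
  shows "contract f g h (product_tensor x y z) = f x * g y * h z"
proof -
  have "contract f g h (product_tensor x y z) = (\<Sum>i\<in>UNIV. \<Sum>j\<in>UNIV. \<Sum>l\<in>UNIV.
      (vec_nth x i * f (axis i 1)) * ((vec_nth y j * g (axis j 1)) * (vec_nth z l * h (axis l 1))))"
    unfolding contract_def product_tensor_def sum.cartesian_product
    by (simp add: mult_ac split_def)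
  also have "\<dots> = f x * (g y * h z)"
    unfolding linear_functional_expand[OF assms(1), of x] linear_functional_expand[OF assms(2), of y]
      linear_functional_expand[OF assms(3), of z] sum_product by (simp add: sum_distrib_left sum_distrib_right)
  finally show ?thesis by (simp add: mult.assoc)
qed

lemma contract_sum: "contract f g h (\<Sum>t\<in>A. X t) = (\<Sum>t\<in>A. contract f g h (X t))"
  unfolding contract_def split_def by (subst sum.swap) (simp add: sum_distrib_right)

lemma mv_polynomial_contract: "mv_polynomial (contract f g h)"
  unfolding contract_def[abs_def] split_def
  by (intro mv_polynomial_sum mv_polynomial_mult mv_polynomial_const mv_polynomial_coord)

text \<open>Makes \<open>vol\<close> usable as the first functional in \<open>contract\<close>.
  Additivity is \<open>vol_expand\<close> with two terms indexed by the Booleans, homogeneity is the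
  case of one term.\<close>

lemma linear_vol:
  fixes \<kappa> :: "'k::field ^ 'n \<Rightarrow> nat \<Rightarrow> 'k"
  assumes lin: "\<And>l. Vector_Spaces.linear (*s) (*) (\<lambda>x. \<kappa> x l)"
    and len: "Suc (length us + length ws) = n"
  shows "Vector_Spaces.linear (*s) (*) (\<lambda>x. vol n (us @ \<kappa> x # ws))"
proof -
  have upd: "(us @ w # ws)[length us := w'] = us @ w' # ws" for w w' :: "nat \<Rightarrow> 'k"
    by simp
  have "vol n (us @ \<kappa> (x + y) # ws) = vol n (us @ \<kappa> x # ws) + vol n (us @ \<kappa> y # ws)" for x y
  proof -
    have "vol n ((us @ \<kappa> 0 # ws)[length us := \<kappa> (x + y)]) =
        (\<Sum>b\<in>UNIV. 1 * vol n ((us @ \<kappa> 0 # ws)[length us := \<kappa> (if b then x else y)]))"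
      by (rule vol_expand) (use len module_hom.add[OF lin[THEN module_hom_linearI]] in \<open>auto simp: UNIV_bool\<close>)
    then show ?thesis by (simp add: UNIV_bool add.commute)
  qed
  moreover have "vol n (us @ \<kappa> (r *s x) # ws) = r * vol n (us @ \<kappa> x # ws)" for r x
  proof -
    have "vol n ((us @ \<kappa> 0 # ws)[length us := \<kappa> (r *s x)]) =
        (\<Sum>b\<in>{()}. r * vol n ((us @ \<kappa> 0 # ws)[length us := \<kappa> x]))"
      by (rule vol_expand) (use len module_hom.scale[OF lin[THEN module_hom_linearI]] in auto)
    then show ?thesis by simp
  qed
  ultimately show ?thesis
    unfolding Vector_Spaces.linear_iff
    by (simp add: vec.vector_space_axioms vector_space_over_itself.vector_space_axioms)
qed

text \<open>The polynomial is a maximal minor of the \<open>p\<close>-th Koszul flattening of the tensor with respect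
  to its first factor, \<open>p = r - k\<^sub>b\<close>. Rows and columns are indexed by the pairs \<open>(j, U)\<close> with \<open>U\<close> a
  \<open>p\<close>-subset of \<open>J j\<close>, where \<open>a j\<close> and \<open>a ` J j\<close> form a basis of the span of all \<open>a i\<close>; the choice
  of dual functionals makes the minor of the given tensor diagonal.\<close>

lemma separating_polynomial:
  fixes a :: "nat \<Rightarrow> 'k::field ^ 'n1" and b :: "nat \<Rightarrow> 'k ^ 'n2" and c :: "nat \<Rightarrow> 'k ^ 'n3"
  assumes I: "finite I" and nz: "\<forall>i\<in>I. a i \<noteq> 0"
    and a: "L \<subseteq> I" "inj_on a L" "vec.independent (a ` L)"
    and b: "\<And>J. J \<subseteq> I \<Longrightarrow> card J \<le> k_b \<Longrightarrow> inj_on b J \<and> vec.independent (b ` J)"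
    and c: "\<And>J. J \<subseteq> I \<Longrightarrow> card J \<le> k_c \<Longrightarrow> inj_on c J \<and> vec.independent (c ` J)"
    and k: "2 * card I < card L + k_b + k_c" "k_b \<le> card I" "k_c \<le> card I"
    and s: "s < card I"
  obtains P :: "('k, 'n1, 'n2, 'n3) tensor \<Rightarrow> 'k" where
    "mv_polynomial P" "\<And>X. X \<in> product_tensor_sums s \<Longrightarrow> P X = 0"
    "P (\<Sum>i\<in>I. product_tensor (a i) (b i) (c i)) \<noteq> 0"
proof -
  obtain \<kappa> J N where
    lin: "\<And>l. Vector_Spaces.linear (*s) (*) (\<lambda>x. \<kappa> x l)"
    and J: "\<And>j. j \<in> I \<Longrightarrow> J j \<subseteq> I - {j} \<and> Suc (card (J j)) = N"
    and basis: "\<And>j js. j \<in> I \<Longrightarrow> distinct js \<Longrightarrow> set js = insert j (J j) \<Longrightarrow>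
      vol N (map (\<lambda>i. \<kappa> (a i)) js) \<noteq> 0"
    and N: "\<And>L. L \<subseteq> I \<Longrightarrow> inj_on a L \<Longrightarrow> vec.independent (a ` L) \<Longrightarrow> card L \<le> N"
    by (rule spanning_coordinates[OF I nz]) (rule that)
  define p where "p = card I - k_b"
  define q where "q = N - 1 - p"
  have NL: "card L \<le> N" using N a by blast
  \<comment> \<open>Since \<open>k_c \<le> card I\<close> and \<open>card L \<le> N\<close>, the
    Kruskal condition forces p < N, so the subtractions defining p and q do not truncate.\<close>
  have pq: "Suc (p + q) = N" and p: "card I - p \<le> k_b" and q: "card I - q \<le> k_c"
    using NL k by (auto simp: p_def q_def)
  have finJ: "finite (J j)" "j \<notin> J j" "card (J j) = p + q" "J j \<subseteq> I" if "j \<in> I" for j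
    using J[OF that] I pq by (auto intro: finite_subset)
  define \<alpha> where "\<alpha> U = map (\<lambda>i. \<kappa> (a i)) (sorted_list_of_set U)" for U
  define D where "D j = {U. U \<subseteq> J j \<and> card U = p}" for j
  have compl: "J j - U \<subseteq> I" "card (J j - U) = q" "finite U" if "j \<in> I" "U \<in> D j" for j U
    using that finJ[of j] finite_subset[of U "J j"] by (auto simp: D_def card_Diff_subset)
  \<comment> \<open>Removing U leaves at most \<open>k_b\<close> of the \<open>b i\<close>, still
    including \<open>b j\<close>; they are independent, so \<open>b j\<close> has a dual functional
    among them.\<close>
  have "\<exists>g. Vector_Spaces.linear (*s) (*) g \<and> g (b j) = 1 \<and> (\<forall>i\<in>I - U - {j}. g (b i) = 0)"
    if "j \<in> I" "U \<in> D j" for j U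
  proof -
    have "U \<subseteq> I" "card U = p" "j \<notin> U" using that finJ[of j] by (auto simp: D_def)
    then have "card (I - U) \<le> k_b" using compl[OF that] p by (simp add: card_Diff_subset)
    then show ?thesis
      using \<open>j \<notin> U\<close> that by (intro dual_functional b) auto
  qed
  then obtain \<beta> where \<beta>: "\<And>j U. j \<in> I \<Longrightarrow> U \<in> D j \<Longrightarrow> Vector_Spaces.linear (*s) (*) (\<beta> j U) \<and>
      \<beta> j U (b j) = 1 \<and> (\<forall>i\<in>I - U - {j}. \<beta> j U (b i) = 0)"
    by metis
  \<comment> \<open>The same for the \<open>c i\<close>, removing instead the q elements of
    \<open>J j - U\<close>.\<close>
  have "\<exists>g. Vector_Spaces.linear (*s) (*) g \<and> g (c j) = 1 \<and> (\<forall>i\<in>I - (J j - U) - {j}. g (c i) = 0)"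
    if "j \<in> I" "U \<in> D j" for j U
  proof -
    have "card (I - (J j - U)) \<le> k_c"
      using compl[OF that] q finJ[OF that(1)] by (simp add: card_Diff_subset)
    then show ?thesis
      using finJ(2)[OF that(1)] that by (intro dual_functional c) auto
  qed
  then obtain \<gamma> where \<gamma>: "\<And>j U. j \<in> I \<Longrightarrow> U \<in> D j \<Longrightarrow> Vector_Spaces.linear (*s) (*) (\<gamma> j U) \<and>
      \<gamma> j U (c j) = 1 \<and> (\<forall>i\<in>I - (J j - U) - {j}. \<gamma> j U (c i) = 0)"
    by metis
  define E where "E = Sigma I D"
  have cardD: "card (D j) = (p + q) choose p" and finD: "finite (D j)" if "j \<in> I" for j
    using n_subsets[of "J j" p] finJ[OF that] by (auto simp: D_def)
  have cardE: "card E = card I * ((p + q) choose p)" and finE: "finite E"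
    unfolding E_def using I finD cardD by (auto simp: card_SigmaI)
  define M where "M = card E"
  obtain h where h: "bij_betw h {0..<M} E"
    using finE ex_bij_betw_nat_finite unfolding M_def by blast
  have hE: "h i \<in> E" if "i < M" for i
    using h that by (auto simp: bij_betw_def)
  define us where "us e = \<alpha> (snd e)" for e :: "nat \<times> nat set"
  define ws where "ws e = \<alpha> (J (fst e) - snd e)" for e
  have len: "length (us e) = p" "length (ws e) = q" if eE: "e \<in> E" for e
  proof -
    obtain j U where e: "e = (j, U)" "j \<in> I" "U \<in> D j"
      using eE by (cases e) (auto simp: E_def)
    then show "length (us e) = p" "length (ws e) = q"
      using compl(2)[OF e(2,3)] by (simp_all add: us_def ws_def \<alpha>_def D_def)
  qed
  \<comment> \<open>The minor's entry in row e and column e': the column feeds the wedge over its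
    subset and \<open>\<beta>\<close> into the flattening, and the row reads the result off by
    wedging with the complementary vectors and applying \<open>\<gamma>\<close>.\<close>
  define W where "W e e' = contract (\<lambda>x. vol N (us e' @ \<kappa> x # ws e)) (case_prod \<beta> e') (case_prod \<gamma> e)" for e e'
  have W: "W e e' (product_tensor x y z) =
      vol N (us e' @ \<kappa> x # ws e) * case_prod \<beta> e' y * case_prod \<gamma> e z"
    if "e \<in> E" "e' \<in> E" for e e' x y z
    unfolding W_def
  proof (rule contract_product_tensor)
    show "Vector_Spaces.linear (*s) (*) (\<lambda>x. vol N (us e' @ \<kappa> x # ws e))"
      using len that pq by (intro linear_vol lin) simp
    show "Vector_Spaces.linear (*s) (*) (case_prod \<beta> e')" "Vector_Spaces.linear (*s) (*) (case_prod \<gamma> e)"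
      using that \<beta> \<gamma> by (cases e, cases e', simp add: E_def)+
  qed
  define P where "P X = Determinant.det (Matrix.mat M M (\<lambda>(i, i'). W (h i) (h i') X))" for X
  have "mv_polynomial P"
    unfolding P_def[abs_def] W_def by (intro mv_polynomial_det mv_polynomial_contract)
  moreover have "P X = 0" if X: "X \<in> product_tensor_sums s" for X
  proof -
    obtain x y z where X: "X = (\<Sum>t\<in>{1..s}. product_tensor (x t) (y t) (z t))"
    proof -
      obtain w where w: "X = (\<Sum>t\<in>{1..s}. w t)" "\<forall>t\<in>{1..s}. w t \<in> product_tensors"
        using X by (auto simp: product_tensor_sums_def)
      then have "\<forall>t\<in>{1..s}. \<exists>x y z. w t = product_tensor x y z"
        by (auto simp: product_tensors_def)
      then obtain x y z where "\<forall>t\<in>{1..s}. w t = product_tensor (x t) (y t) (z t)"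
        by metis
      then show thesis using that[of x y z] w(1) by simp
    qed
    \<comment> \<open>For a single product tensor, \<open>vol_factor\<close> separates the column
      data \<open>us\<close> from the row data \<open>ws\<close>, which bounds the rank of its
      contribution by \<open>(p + q) choose p\<close>.\<close>
    have "\<exists>K \<phi> \<psi>. finite K \<and> card (K :: nat set set) = (p + q) choose p \<and>
        (\<forall>us ws. length us = p \<longrightarrow> length ws = q \<longrightarrow>
          vol N (us @ \<kappa> (x t) # ws) = (\<Sum>V\<in>K. \<phi> V us * \<psi> V ws))" for t
    proof -
      obtain K :: "nat set set" and \<phi> \<psi> where "finite K" "card K = (p + q) choose p"
        "\<And>us ws. length us = p \<Longrightarrow> length ws = q \<Longrightarrow>
          vol (Suc (p + q)) (us @ \<kappa> (x t) # ws) = (\<Sum>V\<in>K. \<phi> V us * \<psi> V ws)"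
        by (rule vol_factor[of p q "\<kappa> (x t)"]) (rule that)
      then show ?thesis
        unfolding pq by (intro exI[of _ K] exI[of _ \<phi>] exI[of _ \<psi>]) simp
    qed
    then have "\<forall>t. \<exists>K \<phi> \<psi>. finite K \<and> card (K :: nat set set) = (p + q) choose p \<and>
        (\<forall>us ws. length us = p \<longrightarrow> length ws = q \<longrightarrow>
          vol N (us @ \<kappa> (x t) # ws) = (\<Sum>V\<in>K. \<phi> V us * \<psi> V ws))" ..
    then obtain K \<phi> \<psi> where *: "\<forall>t. finite (K t) \<and> card (K t :: nat set set) = (p + q) choose p \<and>
        (\<forall>us ws. length us = p \<longrightarrow> length ws = q \<longrightarrow>
          vol N (us @ \<kappa> (x t) # ws) = (\<Sum>V\<in>K t. \<phi> t V us * \<psi> t V ws))"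
      unfolding choice_iff by (elim exE) (rule that)
    have K: "finite (K t)" "card (K t) = (p + q) choose p" for t
      using * by auto
    have fac: "vol N (us @ \<kappa> (x t) # ws) = (\<Sum>V\<in>K t. \<phi> t V us * \<psi> t V ws)"
      if "length us = p" "length ws = q" for t us ws
      using * that by blast
    \<comment> \<open>Indexes s times \<open>(p + q) choose p\<close> terms of rank at most one,
      fewer than the size M of the minor, which has \<open>card I\<close> in place of s.\<close>
    define S where "S = Sigma {1..s} K"
    define f where "f i = (\<lambda>(t, V). \<psi> t V (ws (h i)) * case_prod \<gamma> (h i) (z t))" for i
    define g where "g = (\<lambda>(t, V) i. \<phi> t V (us (h i)) * case_prod \<beta> (h i) (y t))"
    have "W (h i) (h i') X = (\<Sum>k\<in>S. f i k * g k i')" if "i < M" "i' < M" for i i'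
    proof -
      have "W (h i) (h i') X = (\<Sum>t\<in>{1..s}. W (h i) (h i') (product_tensor (x t) (y t) (z t)))"
        unfolding X W_def contract_sum ..
      also have "\<dots> = (\<Sum>t\<in>{1..s}. \<Sum>V\<in>K t. f i (t, V) * g (t, V) i')"
        using that hE len by (simp add: W fac f_def g_def sum_distrib_left sum_distrib_right mult_ac)
      also have "\<dots> = (\<Sum>k\<in>S. f i k * g k i')"
        unfolding S_def using K by (subst sum.Sigma) (auto simp: split_def)
      finally show ?thesis .
    qed
    then have "Matrix.mat M M (\<lambda>(i, i'). W (h i) (h i') X) =
        Matrix.mat M M (\<lambda>(i, i'). \<Sum>k\<in>S. f i k * g k i')"
      by (intro eq_matI) auto
    moreover have "finite S" "card S < M"
      using K s by (auto simp: S_def card_SigmaI M_def cardE)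
    ultimately show ?thesis
      unfolding P_def by (simp only: det_low_rank)
  qed
  moreover have "P (\<Sum>i\<in>I. product_tensor (a i) (b i) (c i)) \<noteq> 0"
  proof -
    let ?T = "\<Sum>i\<in>I. product_tensor (a i) (b i) (c i)"
    \<comment> \<open>A repeated vector in \<open>vol\<close> kills the term if i lies in U' or
      \<open>J j - U\<close>, or if these sets meet. Otherwise \<open>\<beta>\<close> kills it
      unless i = j', and \<open>\<gamma>\<close> unless i = j.\<close>
    have vanish: "vol N (us e' @ \<kappa> (a i) # ws e) * case_prod \<beta> e' (b i) * case_prod \<gamma> e (c i) = 0"
      if e: "e \<in> E" "e' \<in> E" and i: "i \<in> I" and ne: "e \<noteq> e' \<or> i \<noteq> fst e" for e e' i
    proof -
      obtain j U j' U' where [simp]: "e = (j, U)" "e' = (j', U')" by (cases e, cases e') auto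
      have j: "j \<in> I" "U \<in> D j" "j' \<in> I" "U' \<in> D j'" using e by (auto simp: E_def)
      consider "i \<in> U'" | "i \<in> J j - U" | "i \<notin> U'" "i \<noteq> j'" | "i \<notin> J j - U" "i \<noteq> j"
        | "i = j" "j = j'" "U \<noteq> U'"
        using ne by auto
      then consider "U' \<inter> (J j - U) \<noteq> {} \<or> i \<in> U' \<or> i \<in> J j - U"
        | "i \<in> I - U' - {j'}" | "i \<in> I - (J j - U) - {j}"
      proof cases
        case 5
        \<comment> \<open>U and U' are different p-subsets of the same \<open>J j\<close>, so U'
          must meet the complement of U.\<close>
        have "\<not> U' \<subseteq> U"
          using 5(3) j(2,4) compl(3)[OF j(1,2)] card_subset_eq[of U U'] by (auto simp: D_def)
        moreover have "U' \<subseteq> J j" using j 5 by (simp add: D_def)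
        ultimately show ?thesis using that(1) by blast
      qed (use i in blast)+
      then show ?thesis
      proof cases
        case 1
        have fin: "finite U'" "finite (J j - U)"
          using compl(3)[OF j(3,4)] finJ(1)[OF j(1)] by auto
        have "us e' @ \<kappa> (a i) # ws e =
            map (\<lambda>i. \<kappa> (a i)) (sorted_list_of_set U' @ i # sorted_list_of_set (J j - U))"
          by (simp add: us_def ws_def \<alpha>_def)
        moreover have "\<not> distinct (sorted_list_of_set U' @ i # sorted_list_of_set (J j - U))"
          using 1 fin by auto
        ultimately have "\<not> distinct (us e' @ \<kappa> (a i) # ws e)"
          by (simp only: distinct_map simp_thms)
        moreover have "length (us e' @ \<kappa> (a i) # ws e) = N"
          using len[OF e(1)] len[OF e(2)] pq by simp
        ultimately have "vol N (us e' @ \<kappa> (a i) # ws e) = 0"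
          by (intro vol_not_distinct)
        then show ?thesis by (simp only: mult_zero_left)
      next
        case 2
        then show ?thesis using \<beta>[OF j(3,4)] by simp
      next
        case 3
        then show ?thesis using \<gamma>[OF j(1,2)] by simp
      qed
    qed
    have WT: "W e e' ?T = (\<Sum>i\<in>I. vol N (us e' @ \<kappa> (a i) # ws e) * case_prod \<beta> e' (b i) * case_prod \<gamma> e (c i))"
      if "e \<in> E" "e' \<in> E" for e e'
    proof -
      have "W e e' ?T = (\<Sum>i\<in>I. W e e' (product_tensor (a i) (b i) (c i)))"
        unfolding W_def contract_sum ..
      then show ?thesis by (simp only: W[OF that])
    qed
    have diag: "W e e ?T \<noteq> 0" if e: "e \<in> E" for e
    proof -
      obtain j U where [simp]: "e = (j, U)" by (cases e) auto
      have j: "j \<in> I" "U \<in> D j" using e by (auto simp: E_def)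
      define w where "w i = vol N (us e @ \<kappa> (a i) # ws e) * case_prod \<beta> e (b i) * case_prod \<gamma> e (c i)" for i
      have "W e e ?T = (\<Sum>i\<in>I. w i)"
        unfolding w_def by (rule WT[OF e e])
      also have "\<dots> = w j + (\<Sum>i\<in>I - {j}. w i)"
        by (rule sum.remove[OF I j(1)])
      also have "(\<Sum>i\<in>I - {j}. w i) = 0"
        unfolding w_def by (intro sum.neutral ballI vanish[OF e e]) auto
      also have "w j + 0 = vol N (us e @ \<kappa> (a j) # ws e) * case_prod \<beta> e (b j) * case_prod \<gamma> e (c j)"
        by (simp add: w_def)
      \<comment> \<open>For i = j both dual functionals equal 1, and the vectors left in
        \<open>vol\<close> are those of the basis given by j and \<open>J j\<close>.\<close>
      also have "\<dots> = vol N (map (\<lambda>i. \<kappa> (a i)) (sorted_list_of_set U @ j # sorted_list_of_set (J j - U)))"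
        using \<beta>[OF j] \<gamma>[OF j] by (simp add: us_def ws_def \<alpha>_def)
      also have "\<dots> \<noteq> 0"
        using j compl[OF j] finJ[OF j(1)] by (intro basis[OF j(1)]) (auto simp: D_def)
      finally show ?thesis .
    qed
    show ?thesis
      unfolding P_def
    proof (rule det_diagonal)
      fix i i' assume i: "i < M" "i' < M" "i \<noteq> i'"
      then have "h i \<noteq> h i'" using h by (auto simp: bij_betw_def inj_on_def)
      then show "W (h i) (h i') ?T = 0"
        unfolding WT[OF hE[OF i(1)] hE[OF i(2)]]
        by (intro sum.neutral ballI vanish hE i disjI1)
    next
      show "W (h i) (h i) ?T \<noteq> 0" if "i < M" for i
        using diag hE that by blast
    qed
  qed
  ultimately show thesis by (rule that)
qed

section \<open>Rank and border rank from the separating polynomial\<close>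

theorem theorem1p1:
  fixes T :: "('k::field, 'n1::finite, 'n2::finite, 'n3::finite) tensor"
    and a :: "nat \<Rightarrow> 'k ^ 'n1" and b :: "nat \<Rightarrow> 'k ^ 'n2" and c :: "nat \<Rightarrow> 'k ^ 'n3"
    and r k_a k_b k_c :: nat
  assumes "r \<ge> 1"
    and "\<forall>i\<in>{1..r}. a i \<noteq> 0 \<and> b i \<noteq> 0 \<and> c i \<noteq> 0"
    and "T = (\<Sum>i\<in>{1..r}. product_tensor (a i) (b i) (c i))"
    and "k_a = kruskal_rank (image_mset a (mset_set {1..r}))"
    and "k_b = kruskal_rank (image_mset b (mset_set {1..r}))"
    and "k_c = kruskal_rank (image_mset c (mset_set {1..r}))"
    and "2 * r \<le> k_a + k_b + k_c - 1"
  shows "border_rank T = r \<and> tensor_rank T = r"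
proof -
  have I: "finite {1..r}" "{1..r} \<noteq> {}" using assms(1) by auto
  note ka = kruskal_rank_independent[OF I, of a, folded assms(4)]
    and kb = kruskal_rank_independent[OF I, of b, folded assms(5)]
    and kc = kruskal_rank_independent[OF I, of c, folded assms(6)]
  have nz: "a i \<noteq> 0" "b i \<noteq> 0" "c i \<noteq> 0" if "i \<in> {1..r}" for i
    using assms(2) that by auto
  \<comment> \<open>With this inclusion, membership of T for r bounds both ranks above, and
    exclusion from the closure for s < r bounds both below.\<close>
  have closure: "S \<subseteq> zariski_closure S" for S :: "('k, 'n1, 'n2, 'n3) tensor set"
    by (auto simp: zariski_closure_def)
  have mem: "T \<in> product_tensor_sums r"
    unfolding product_tensor_sums_def product_tensors_def assms(3) by auto
  have not_mem: "T \<notin> zariski_closure (product_tensor_sums s)" if s: "s < r" for s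
  proof -
    \<comment> \<open>Any \<open>k_a\<close> of the \<open>a i\<close> are independent and bound the
      dimension of the span from below; the first ones are taken.\<close>
    have L: "{1..k_a} \<subseteq> {1..r}" using ka(2) nz by simp
    obtain P :: "('k, 'n1, 'n2, 'n3) tensor \<Rightarrow> 'k" where P: "mv_polynomial P"
      "\<And>X. X \<in> product_tensor_sums s \<Longrightarrow> P X = 0" "P T \<noteq> 0"
      unfolding assms(3)
    proof (rule separating_polynomial[where I = "{1..r}" and L = "{1..k_a}" and ?k_b = k_b and ?k_c = k_c and a = a and b = b and c = c and s = s])
      \<comment> \<open>As \<open>k_a\<close> is at least 1, the subtraction of 1 in the Kruskal
        condition does not truncate, and the condition becomes a strict inequality.\<close>
      show "2 * card {1..r} < card {1..k_a} + k_b + k_c"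
        using assms(7) ka(1) nz by simp
    qed (use L nz s ka kb kc in auto)
    obtain f :: "('n1 \<times> 'n2 \<times> 'n3, 'k) mv_poly" where "\<And>X. mv_eval f X = P X"
      using P(1) unfolding mv_polynomial_def by blast
    then show ?thesis
      using P(2,3) by (auto simp: zariski_closure_def intro!: exI[of _ f])
  qed
  have "border_rank T = r"
    unfolding border_rank_def
    by (rule Least_equality) (use mem closure not_mem in \<open>auto simp: not_less[symmetric]\<close>)
  moreover have "tensor_rank T = r"
    unfolding tensor_rank_def
  proof (rule Least_equality)
    show "r \<le> s" if "T \<in> product_tensor_sums s" for s
      using that closure not_mem by (meson not_le subsetD)
  qed (rule mem)
  ultimately show ?thesis ..
qed

end
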